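(* Let $p\ge1$, let $\mathcal{X}\in L^{0}[\mathcal{F}_{c}(\mathbb{R}^{p})]$ be any fuzzy random variable and let $B\in\mathfrak{B}$, where $$\mathfrak{B}=\{B\in\mathcal{F}_{c}(\mathbb{R}^{p}):\ \forall u\in\mathbb{S}^{p-1}\ \exists C_{u}\subseteq[0,1]\text{ with }\nu(C_{u})=1\text{ such that }s_{B}(u,\alpha)\neq0\ \ \forall\alpha\in C_{u}\}.$$ Then: (i) if $A\in\mathcal{F}_{c}(\mathbb{R}^{p})$ maximizes $D_{FS}(\cdot;\mathcal{X})$ over $\mathcal{F}_{c}(\mathbb{R}^{p})$, then $\lim_{n\to\infty}D_{FS}(A+n\cdot B;\mathcal{X})=0$; (ii) if $A\in\mathcal{F}_{c}(\mathbb{R}^{p})$ maximizes $D_{mS}(\cdot;\mathcal{X})$ over $\mathcal{F}_{c}(\mathbb{R}^{p})$, then $\lim_{n\to\infty}D_{mS}(A+n\cdot B;\mathcal{X})=0$.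
   Context: $\mathbb{S}^{p-1}=\{x\in\mathbb{R}^{p}:\|x\|=1\}$ is the unit sphere, $\mathcal{V}_{p}$ is the normalized Haar (uniform probability) measure on $\mathbb{S}^{p-1}$ (for $p=1$, mass $1/2$ at each of $\pm1$), and $\nu$ is Lebesgue measure on $[0,1]$. $\mathcal{K}_{c}(\mathbb{R}^{p})$ is the class of non-empty compact convex subsets of $\mathbb{R}^{p}$. Fuzzy sets: $\mathcal{F}_{c}(\mathbb{R}^{p})$ is the class of functions $A:\mathbb{R}^{p}\to[0,1]$ whose $\alpha$-levels $A_{\alpha}$ are non-empty, compact and convex for all $\alpha\in[0,1]$, where $A_{\alpha}=\{x:A(x)\ge\alpha\}$ for $\alpha\in(0,1]$ and $A_{0}$ is the closure of $\{x:A(x)>0\}$. The support function of $A$ is $s_{A}(u,\alpha)=\sup_{v\in A_{\alpha}}\langle u,v\rangle$, $(u,\alpha)\in\mathbb{S}^{p-1}\times[0,1]$. Operations: $(A+B)(t)=\sup_{x+y=t}\min\{A(x),B(y)\}$; for real $\gamma\ne0$, $(\gamma\cdot A)(t)=A(t/\gamma)$, and $0\cdot A=\mathrm{I}_{\{0\}}$ (indicator function of $\{0\}$). Fuzzy random variables: let $(\Omega,\mathcal{A},\mathbb{P})$ be a probability space. A random compact set is a map $\Gamma:\Omega\to\mathcal{K}_{c}(\mathbb{R}^{p})$ with $\{\omega:\Gamma(\omega)\cap K\neq\emptyset\}\in\mathcal{A}$ for each $K\in\mathcal{K}_{c}(\mathbb{R}^{p})$. A fuzzy random variable is a map $\mathcal{X}:\Omega\to\mathcal{F}_{c}(\mathbb{R}^{p})$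 such that for every $\alpha\in[0,1]$ the $\alpha$-level map $\omega\mapsto\mathcal{X}(\omega)_{\alpha}$ is a random compact set. $L^{0}[\mathcal{F}_{c}(\mathbb{R}^{p})]$ is the class of all fuzzy random variables; $s_{\mathcal{X}}(u,\alpha)$ denotes the real random variable $\omega\mapsto s_{\mathcal{X}(\omega)}(u,\alpha)$. Depths: let $\mathcal{X}_{1},\ldots,\mathcal{X}_{p+1}$ be independent copies of $\mathcal{X}$ and $m_{\mathcal{X}}(u,\alpha)=\min_{1\le i\le p+1}s_{\mathcal{X}_{i}}(u,\alpha)$, $M_{\mathcal{X}}(u,\alpha)=\max_{1\le i\le p+1}s_{\mathcal{X}_{i}}(u,\alpha)$. For $A\in\mathcal{F}_{c}(\mathbb{R}^{p})$, $$D_{mS}(A;\mathcal{X})=\mathrm{E}\big[(\mathcal{V}_{p}\otimes\nu)\{(u,\alpha)\in\mathbb{S}^{p-1}\times[0,1]:s_{A}(u,\alpha)\in[m_{\mathcal{X}}(u,\alpha),M_{\mathcal{X}}(u,\alpha)]\}\big],$$ $$D_{FS}(A;\mathcal{X})=\inf_{u\in\mathbb{S}^{p-1}}\mathrm{E}\big[\nu\{\alpha\in[0,1]:s_{A}(u,\alpha)\in[m_{\mathcal{X}}(u,\alpha),M_{\mathcal{X}}(u,\alpha)]\}\big].$$ *)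

theory Defs
  imports "HOL-Probability.Probability"
begin

text \<open>The library has no surface measure. We take the radial projection of the uniform
  distribution on the closed unit ball, viewed as a Borel measure on the sphere (the origin, sent
  to itself by the projection, is a null set). The lemmas below show that it is a Borel probability
  measure invariant under all orthogonal maps, i.e. the normalized Haar measure.\<close>

definition sphere_measure :: "(real ^ 'n) measure" where
  "sphere_measure = restrict_space
     (distr (uniform_measure lborel (cball 0 1)) borel (\<lambda>x. x /\<^sub>R norm x)) (sphere 0 1)"

lemma space_sphere_measure [simp]: "space sphere_measure = sphere 0 1"
  by (simp add: sphere_measure_def space_restrict_space)

lemma sets_sphere_measure [measurable_cong]:
  "sets sphere_measure = sets (restrict_space borel (sphere 0 1))"
  by (simp add: sphere_measure_def sets_restrict_space)

lemma emeasure_sphere_measure: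
  assumes "S \<in> sets borel" "S \<subseteq> sphere (0 :: real ^ 'n) 1"
  shows "emeasure sphere_measure S =
    emeasure (uniform_measure lborel (cball 0 1)) ((\<lambda>x. x /\<^sub>R norm x) -` S)"
  using assms unfolding sphere_measure_def
  by (subst emeasure_restrict_space) (auto simp: emeasure_distr)

lemma emeasure_unit_cball:
  "emeasure lborel (cball (0 :: real ^ 'n) 1) \<noteq> 0"
  "emeasure lborel (cball (0 :: real ^ 'n) 1) \<noteq> \<infinity>"
proof -
  show "emeasure lborel (cball (0 :: real ^ 'n) 1) \<noteq> 0"
    using content_cball_pos[of 1 "0 :: real ^ 'n"]
    by (metis (no_types) measure_def measure_completion enn2real_0 sets_lborel borel_closed
        closed_cball less_irrefl zero_less_one)
  show "emeasure lborel (cball (0 :: real ^ 'n) 1) \<noteq> \<infinity>"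
    using emeasure_bounded_finite[of "cball (0 :: real ^ 'n) 1"] by simp
qed

lemma prob_space_uniform_cball:
  "prob_space (uniform_measure lborel (cball (0 :: real ^ 'n) 1))"
  by (rule prob_space_uniform_measure) (rule emeasure_unit_cball)+

lemma prob_space_sphere_measure: "prob_space (sphere_measure :: (real ^ 'n) measure)"
proof
  let ?U = "uniform_measure lborel (cball (0 :: real ^ 'n) 1)"
  interpret U: prob_space ?U by (rule prob_space_uniform_cball)
  have "(\<lambda>x :: real ^ 'n. x /\<^sub>R norm x) -` sphere 0 1 = - {0}"
    by (auto simp: dist_norm)
  then have "emeasure sphere_measure (space (sphere_measure :: (real ^ 'n) measure))
      = emeasure ?U (- {0})"
    by (simp add: emeasure_sphere_measure)
  also have "\<dots> = 1"
  proof -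
    have "emeasure lborel (cball (0 :: real ^ 'n) 1 \<inter> {0}) = 0"
      by (rule emeasure_lborel_countable) auto
    then have "emeasure ?U {0} = 0"
      by (simp add: divide_ennreal_def)
    then have "U.prob {0} = 0"
      by (simp add: measure_def)
    then have "U.prob (space ?U - {0}) = 1"
      using U.prob_compl[of "{0}"] by simp
    then show ?thesis
      by (simp add: U.emeasure_eq_measure Compl_eq_Diff_UNIV)
  qed
  finally show "emeasure sphere_measure (space (sphere_measure :: (real ^ 'n) measure)) = 1" .
qed

lemma nn_integral_lborel_shift:
  fixes f :: "'a::euclidean_space \<Rightarrow> ennreal"
  assumes [measurable]: "f \<in> borel_measurable borel"
  shows "(\<integral>\<^sup>+ y. f (y + a) \<partial>lborel) = (\<integral>\<^sup>+ y. f y \<partial>lborel)"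
    and "(\<integral>\<^sup>+ y. f (a - y) \<partial>lborel) = (\<integral>\<^sup>+ y. f y \<partial>lborel)"
proof -
  have "(\<integral>\<^sup>+ y. f y \<partial>lborel) = (\<integral>\<^sup>+ y. f (a + y) \<partial>lborel)"
    by (subst lborel_distr_plus[symmetric, of a]) (simp add: nn_integral_distr)
  then show "(\<integral>\<^sup>+ y. f (y + a) \<partial>lborel) = (\<integral>\<^sup>+ y. f y \<partial>lborel)"
    by (simp add: add.commute)
  have "(\<integral>\<^sup>+ y. f y \<partial>lborel) = (\<integral>\<^sup>+ y. f (a - y) \<partial>lborel)"
    by (subst lborel_affine[of "-1" a]) (auto simp: nn_integral_density nn_integral_distr)
  then show "(\<integral>\<^sup>+ y. f (a - y) \<partial>lborel) = (\<integral>\<^sup>+ y. f y \<partial>lborel)"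
    by simp
qed

lemma lborel_distr_orthogonal:
  fixes T :: "real ^ 'n \<Rightarrow> real ^ 'n"
  assumes T: "orthogonal_transformation T"
  shows "distr lborel borel T = lborel"
proof (rule measure_eqI)
  have lin: "linear T" and nT: "\<And>x. norm (T x) = norm x"
    using T by (auto simp: orthogonal_transformation)
  have [measurable]: "T \<in> borel_measurable borel"
    by (simp add: lin linear_continuous_on linear_conv_bounded_linear[symmetric]
        borel_measurable_continuous_onI)
  obtain R where R: "\<And>y. T (R y) = y"
    using orthogonal_transformation_surj[OF T] by (metis surj_def)
  fix S :: "(real ^ 'n) set"
  assume "S \<in> sets (distr lborel borel T)"
  then have [measurable]: "S \<in> sets borel" by simp
  define f g :: "real ^ 'n \<Rightarrow> ennreal"
    where "f = indicator S" and "g = indicator (cball 0 1)"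
  have [measurable]: "f \<in> borel_measurable borel" "g \<in> borel_measurable borel"
    by (auto simp: f_def g_def intro!: borel_measurable_indicator)
  let ?I = "\<lambda>h :: real ^ 'n \<Rightarrow> ennreal. \<integral>\<^sup>+ x. h x \<partial>lborel"
  have gT: "g (T x) = g x" for x
    by (simp add: g_def nT indicator_def)
  have "?I (\<lambda>x. f (T x)) * ?I g = ?I (\<lambda>x. f (T x) * ?I (\<lambda>y. g (y + T x)))"
    by (simp add: nn_integral_lborel_shift nn_integral_multc)
  also have "\<dots> = ?I (\<lambda>x. ?I (\<lambda>y. f (T x) * g (y + T x)))"
    by (simp add: nn_integral_cmult)
  also have "\<dots> = ?I (\<lambda>y. ?I (\<lambda>x. f (T x) * g (y + T x)))"
    by (rule lborel_pair.Fubini') measurable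
  also have "\<dots> = ?I (\<lambda>y. ?I (\<lambda>x. f (T x - y) * g (T x)))"
  proof (rule nn_integral_cong)
    fix y
    have "?I (\<lambda>x. f (T x - y) * g (T x)) = ?I (\<lambda>x. f (T (x + R y) - y) * g (T (x + R y)))"
      by (rule nn_integral_lborel_shift(1)[symmetric]) measurable
    then show "?I (\<lambda>x. f (T x) * g (y + T x)) = ?I (\<lambda>x. f (T x - y) * g (T x))"
      by (simp add: linear_add[OF lin] R add.commute)
  qed
  also have "\<dots> = ?I (\<lambda>x. ?I (\<lambda>y. f (T x - y) * g (T x)))"
    by (rule lborel_pair.Fubini'[symmetric]) measurable
  also have "\<dots> = ?I (\<lambda>x. ?I f * g x)"
    by (simp add: nn_integral_multc nn_integral_lborel_shift gT)
  also have "\<dots> = ?I f * ?I g"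
    by (simp add: nn_integral_cmult)
  finally have eq: "?I (\<lambda>x. f (T x)) * ?I g = ?I f * ?I g" .
  have g: "?I g = emeasure lborel (cball (0 :: real ^ 'n) 1)"
    by (simp add: g_def)
  have "?I g \<noteq> \<infinity>" "?I g \<noteq> 0"
    unfolding g by (rule emeasure_unit_cball)+
  then have "?I (\<lambda>x. f (T x)) = ?I f"
    using eq by (metis ennreal_mult_cancel_left infinity_ennreal_def mult.commute)
  moreover have "?I (\<lambda>x. f (T x)) = emeasure (distr lborel borel T) S"
  proof -
    have "?I (\<lambda>x. f (T x)) = (\<integral>\<^sup>+ x. f x \<partial>distr lborel borel T)"
      by (simp add: nn_integral_distr)
    then show ?thesis
      by (simp add: f_def)
  qed
  ultimately show "emeasure (distr lborel borel T) S = emeasure lborel S"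
    by (simp add: f_def)
qed simp

lemma sphere_measure_orthogonal_invariant:
  fixes T :: "real ^ 'n \<Rightarrow> real ^ 'n"
  assumes T: "orthogonal_transformation T"
  shows "distr sphere_measure sphere_measure T = sphere_measure"
proof (rule measure_eqI)
  have lin: "linear T" and nT: "\<And>x. norm (T x) = norm x"
    using T by (auto simp: orthogonal_transformation)
  have [measurable]: "T \<in> borel_measurable borel"
    by (simp add: lin linear_continuous_on linear_conv_bounded_linear[symmetric]
        borel_measurable_continuous_onI)
  have Tm: "T \<in> measurable sphere_measure sphere_measure"
    unfolding measurable_cong_sets[OF sets_sphere_measure sets_sphere_measure]
    by (rule measurable_restrict_space2)
      (auto simp: space_restrict_space nT intro: measurable_restrict_space1)
  fix S
  assume "S \<in> sets (distr sphere_measure sphere_measure T)"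
  then have S: "S \<in> sets borel" "S \<subseteq> sphere 0 1"
    by (auto simp: sets_sphere_measure sets_restrict_space)
  note [measurable] = S(1)
  have TS: "T -` S \<in> sets borel" "T -` S \<subseteq> sphere 0 1"
    using measurable_sets_borel[of T borel S] S(2) by (auto simp: nT)
  let ?r = "\<lambda>x :: real ^ 'n. x /\<^sub>R norm x"
  have rS: "?r -` S \<in> sets borel"
    by (rule measurable_sets_borel[OF _ S(1)]) measurable
  have rTS: "?r -` (T -` S) \<in> sets borel"
    by (rule measurable_sets_borel[OF _ TS(1)]) measurable
  have "T -` (cball 0 1 \<inter> ?r -` S) = cball 0 1 \<inter> ?r -` (T -` S)"
    by (auto simp: nT linear_scale[OF lin])
  moreover have "emeasure lborel (cball 0 1 \<inter> ?r -` S)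
      = emeasure lborel (T -` (cball 0 1 \<inter> ?r -` S))"
    using rS by (subst lborel_distr_orthogonal[OF T, symmetric]) (simp add: emeasure_distr)
  ultimately have "emeasure sphere_measure (T -` S) = emeasure sphere_measure S"
    using rS rTS S TS
    by (simp add: emeasure_sphere_measure emeasure_uniform_measure)
  moreover have "T -` S \<inter> sphere 0 1 = T -` S"
    using TS(2) by blast
  moreover have "S \<in> sets sphere_measure"
    using S by (auto simp: sets_sphere_measure sets_restrict_space)
  ultimately show "emeasure (distr sphere_measure sphere_measure T) S
      = emeasure sphere_measure S"
    by (simp add: emeasure_distr[OF Tm])
qed simp

definition unit_interval_measure :: "real measure" where
  "unit_interval_measure = lebesgue_on {0..1}"

definition convex_bodies :: "('a::euclidean_space) set set" where
  "convex_bodies = {K. K \<noteq> {} \<and> compact K \<and> convex K}"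

definition level :: "('a::euclidean_space \<Rightarrow> real) \<Rightarrow> real \<Rightarrow> 'a set" where
  "level A \<alpha> = (if \<alpha> = 0 then closure {x. A x > 0} else {x. A x \<ge> \<alpha>})"

definition fuzzy_sets :: "('a::euclidean_space \<Rightarrow> real) set" where
  "fuzzy_sets = {A. (\<forall>x. A x \<in> {0..1}) \<and> (\<forall>\<alpha>\<in>{0..1}. level A \<alpha> \<in> convex_bodies)}"

definition support_fun :: "('a::euclidean_space \<Rightarrow> real) \<Rightarrow> 'a \<Rightarrow> real \<Rightarrow> real" where
  "support_fun A u \<alpha> = (SUP v\<in>level A \<alpha>. u \<bullet> v)"

definition fuzzy_add ::
    "('a::euclidean_space \<Rightarrow> real) \<Rightarrow> ('a \<Rightarrow> real) \<Rightarrow> 'a \<Rightarrow> real" where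
  "fuzzy_add A B t = Sup {min (A x) (B y) | x y. x + y = t}"

definition fuzzy_scale :: "real \<Rightarrow> ('a::euclidean_space \<Rightarrow> real) \<Rightarrow> 'a \<Rightarrow> real" where
  "fuzzy_scale \<gamma> A t = (if \<gamma> = 0 then indicator {0} t else A (t /\<^sub>R \<gamma>))"

definition fuzzy_nonvanishing :: "('a::euclidean_space \<Rightarrow> real) set" where
  "fuzzy_nonvanishing = {B \<in> fuzzy_sets. \<forall>u\<in>sphere 0 1. \<exists>C \<subseteq> {0..1}.
     C \<in> sets unit_interval_measure \<and> measure unit_interval_measure C = 1 \<and>
     (\<forall>\<alpha>\<in>C. support_fun B u \<alpha> \<noteq> 0)}"

definition random_compact_set :: "'w measure \<Rightarrow> ('w \<Rightarrow> 'a::euclidean_space set) \<Rightarrow> bool" where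
  "random_compact_set M \<Gamma> \<longleftrightarrow>
     (\<forall>\<omega>\<in>space M. \<Gamma> \<omega> \<in> convex_bodies) \<and>
     (\<forall>K\<in>convex_bodies. {\<omega> \<in> space M. \<Gamma> \<omega> \<inter> K \<noteq> {}} \<in> sets M)"

definition fuzzy_random_variable ::
    "'w measure \<Rightarrow> ('w \<Rightarrow> 'a::euclidean_space \<Rightarrow> real) \<Rightarrow> bool" where
  "fuzzy_random_variable M X \<longleftrightarrow>
     (\<forall>\<omega>\<in>space M. X \<omega> \<in> fuzzy_sets) \<and>
     (\<forall>\<alpha>\<in>{0..1}. random_compact_set M (\<lambda>\<omega>. level (X \<omega>) \<alpha>))"

text \<open>The coarsest sigma-algebra on the fuzzy sets for which every level map is a random compact
  set. It is the one with respect to which independence and equality in law are understood: fuzzy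
  random variables are exactly the measurable maps into it.\<close>

definition fuzzy_algebra :: "('a::euclidean_space \<Rightarrow> real) measure" where
  "fuzzy_algebra = sigma fuzzy_sets
     {{A \<in> fuzzy_sets. level A \<alpha> \<inter> K \<noteq> {}} | \<alpha> K. \<alpha> \<in> {0..1} \<and> K \<in> convex_bodies}"

lemma fuzzy_random_variable_iff_measurable:
  "fuzzy_random_variable M X \<longleftrightarrow> X \<in> measurable M fuzzy_algebra"
proof
  assume X: "fuzzy_random_variable M X"
  show "X \<in> measurable M fuzzy_algebra"
    unfolding fuzzy_algebra_def
  proof (rule measurable_measure_of)
    show "X \<in> space M \<rightarrow> fuzzy_sets"
      using X by (auto simp: fuzzy_random_variable_def)
    fix S :: "('b \<Rightarrow> real) set"
    assume "S \<in> {{A \<in> fuzzy_sets. level A \<alpha> \<inter> K \<noteq> {}} | \<alpha> K. \<alpha> \<in> {0..1} \<and> K \<in> convex_bodies}"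
    then obtain \<alpha> K where \<alpha>K: "\<alpha> \<in> {0..1}" "K \<in> convex_bodies"
      and S: "S = {A \<in> fuzzy_sets. level A \<alpha> \<inter> K \<noteq> {}}"
      by blast
    have "X -` S \<inter> space M = {\<omega> \<in> space M. level (X \<omega>) \<alpha> \<inter> K \<noteq> {}}"
      using X by (auto simp: S fuzzy_random_variable_def)
    then show "X -` S \<inter> space M \<in> sets M"
      using X \<alpha>K unfolding fuzzy_random_variable_def random_compact_set_def by auto
  qed auto
next
  assume X: "X \<in> measurable M fuzzy_algebra"
  have sp: "space (fuzzy_algebra :: ('b \<Rightarrow> real) measure) = fuzzy_sets"
    by (auto simp: fuzzy_algebra_def space_measure_of_conv)
  have XF: "X \<omega> \<in> fuzzy_sets" if "\<omega> \<in> space M" for \<omega>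
    using measurable_space[OF X that] by (simp add: sp)
  have "{\<omega> \<in> space M. level (X \<omega>) \<alpha> \<inter> K \<noteq> {}} \<in> sets M"
    if "\<alpha> \<in> {0..1}" "K \<in> convex_bodies" for \<alpha> K
  proof -
    have "{A \<in> fuzzy_sets. level A \<alpha> \<inter> K \<noteq> {}} \<in> sets fuzzy_algebra"
      unfolding fuzzy_algebra_def using that by (subst sets_measure_of) auto
    from measurable_sets[OF X this]
    show ?thesis
      using XF by (auto simp: vimage_def Int_def conj_commute cong: conj_cong)
  qed
  then show "fuzzy_random_variable M X"
    using XF by (auto simp: fuzzy_random_variable_def random_compact_set_def fuzzy_sets_def)
qed

text \<open>The copies may live on a probability space other than that of \<open>X\<close>, which need not carry any.\<close>

definition independent_copies ::
    "'w measure \<Rightarrow> ('w \<Rightarrow> 'a::euclidean_space \<Rightarrow> real) \<Rightarrow>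
     'v measure \<Rightarrow> ('i \<Rightarrow> 'v \<Rightarrow> 'a \<Rightarrow> real) \<Rightarrow> 'i set \<Rightarrow> bool" where
  "independent_copies M X N Xs I \<longleftrightarrow>
     prob_space N \<and>
     (\<forall>i\<in>I. fuzzy_random_variable N (Xs i) \<and>
        distr N fuzzy_algebra (Xs i) = distr M fuzzy_algebra X) \<and>
     prob_space.indep_vars N (\<lambda>_. fuzzy_algebra) Xs I"

lemma independent_copies_product:
  assumes M: "prob_space M" and X: "fuzzy_random_variable M X" and I: "I \<noteq> {}"
  shows "independent_copies M X (\<Pi>\<^sub>M i\<in>I. M) (\<lambda>i \<omega>. X (\<omega> i)) I"
proof -
  let ?N = "\<Pi>\<^sub>M i\<in>I. M"
  interpret M: prob_space M by (rule M)
  interpret N: prob_space ?N by (rule prob_space_PiM) (rule M)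
  have X': "X \<in> measurable M fuzzy_algebra"
    using X by (simp add: fuzzy_random_variable_iff_measurable)
  have comp: "(\<lambda>\<omega>. \<omega> i) \<in> measurable ?N M" if "i \<in> I" for i
    using that by simp
  have Xi: "(\<lambda>\<omega>. X (\<omega> i)) \<in> measurable ?N fuzzy_algebra" if "i \<in> I" for i
    using measurable_compose[OF comp[OF that] X'] .
  have dc: "distr ?N M (\<lambda>\<omega>. \<omega> i) = M" if "i \<in> I" for i
    using distr_PiM_component[of I "\<lambda>_. M" i] M that by simp
  have "distr ?N fuzzy_algebra (\<lambda>\<omega>. X (\<omega> i)) = distr M fuzzy_algebra X" if "i \<in> I" for i
    using distr_distr[OF X' comp[OF that]] dc[OF that] by (simp add: comp_def)
  moreover have "N.indep_vars (\<lambda>_. M) (\<lambda>i \<omega>. \<omega> i) I"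
  proof -
    have "distr ?N ?N (\<lambda>\<omega>. \<lambda>i\<in>I. \<omega> i) = distr ?N ?N (\<lambda>\<omega>. \<omega>)"
      by (rule distr_cong) (auto simp: space_PiM PiE_restrict)
    also have "\<dots> = (\<Pi>\<^sub>M i\<in>I. distr ?N M (\<lambda>\<omega>. \<omega> i))"
      by (simp add: distr_id2 dc cong: PiM_cong)
    finally show ?thesis
      using I by (subst N.indep_vars_iff_distr_eq_PiM') auto
  qed
  then have "N.indep_vars (\<lambda>_. fuzzy_algebra) (\<lambda>i \<omega>. X (\<omega> i)) I"
    by (rule N.indep_vars_compose2) (rule X')
  ultimately show ?thesis
    using Xi N.prob_space_axioms
    by (simp add: independent_copies_def fuzzy_random_variable_iff_measurable)
qed

text \<open>Here \<open>Xs\<close> is a family of independent copies, indexed by \<open>{1..p + 1}\<close> where \<open>p = CARD('n)\<close>,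
  on the probability space \<open>N\<close>.\<close>

definition support_min ::
    "(nat \<Rightarrow> 'v \<Rightarrow> real ^ 'n \<Rightarrow> real) \<Rightarrow> 'v \<Rightarrow> real ^ 'n \<Rightarrow> real \<Rightarrow> real" where
  "support_min Xs \<omega> u \<alpha> = Min ((\<lambda>i. support_fun (Xs i \<omega>) u \<alpha>) ` {1..CARD('n) + 1})"

definition support_max ::
    "(nat \<Rightarrow> 'v \<Rightarrow> real ^ 'n \<Rightarrow> real) \<Rightarrow> 'v \<Rightarrow> real ^ 'n \<Rightarrow> real \<Rightarrow> real" where
  "support_max Xs \<omega> u \<alpha> = Max ((\<lambda>i. support_fun (Xs i \<omega>) u \<alpha>) ` {1..CARD('n) + 1})"

definition depth_mS ::
    "'v measure \<Rightarrow> (nat \<Rightarrow> 'v \<Rightarrow> real ^ 'n \<Rightarrow> real) \<Rightarrow> (real ^ 'n \<Rightarrow> real) \<Rightarrow> real" where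
  "depth_mS N Xs A = (\<integral>\<omega>. measure (sphere_measure \<Otimes>\<^sub>M unit_interval_measure)
     {(u, \<alpha>) \<in> sphere 0 1 \<times> {0..1}.
        support_fun A u \<alpha> \<in> {support_min Xs \<omega> u \<alpha> .. support_max Xs \<omega> u \<alpha>}} \<partial>N)"

definition depth_FS ::
    "'v measure \<Rightarrow> (nat \<Rightarrow> 'v \<Rightarrow> real ^ 'n \<Rightarrow> real) \<Rightarrow> (real ^ 'n \<Rightarrow> real) \<Rightarrow> real" where
  "depth_FS N Xs A = (INF u\<in>sphere 0 1. \<integral>\<omega>. measure unit_interval_measure
     {\<alpha> \<in> {0..1}.
        support_fun A u \<alpha> \<in> {support_min Xs \<omega> u \<alpha> .. support_max Xs \<omega> u \<alpha>}} \<partial>N)"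

end

theory Submission
  imports Defs
begin

text \<open>Support functions are additive, so off a null set of levels \<open>\<bar>s\<^bsub>A + nB\<^esub>(u, \<alpha>)\<bar>\<close> grows
  linearly in \<open>n\<close> and eventually leaves the band \<open>[m(u, \<alpha>), M(u, \<alpha>)]\<close>, which is fixed for each
  \<open>\<omega>\<close>. Dominated convergence, applied in \<open>\<alpha>\<close>, then in \<open>u\<close>, then in \<open>\<omega>\<close>, gives both limits.
  No measurability has to be established for this: \<open>measure\<close> and \<open>integral\<^sup>L\<close> are \<open>0\<close> on
  non-measurable sets and functions, and such terms of a sequence cannot spoil convergence to \<open>0\<close>.\<close>

section \<open>Limit theorems without measurability assumptions\<close>

text \<open>Replacing each non-measurable \<open>f n\<close> by 0 changes no integral and keeps the
  pointwise limit; dominated convergence with a constant bound then applies to the measurable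
  \<open>g n\<close>.\<close>

lemma (in finite_measure) integral_tendsto_zero_bounded:
  fixes f :: "nat \<Rightarrow> 'a \<Rightarrow> real"
  assumes lim: "AE x in M. (\<lambda>n. f n x) \<longlonglongrightarrow> 0"
    and bound: "\<And>n x. \<bar>f n x\<bar> \<le> c"
  shows "(\<lambda>n. \<integral>x. f n x \<partial>M) \<longlonglongrightarrow> 0"
proof -
  define g where "g n = (if f n \<in> borel_measurable M then f n else (\<lambda>_. 0))" for n
  have c: "0 \<le> c"
    using bound[of 0 undefined] by linarith
  have "(\<lambda>n. \<integral>x. g n x \<partial>M) \<longlonglongrightarrow> (\<integral>x. 0 \<partial>M)"
  proof (rule integral_dominated_convergence[where w = "\<lambda>_. c"])
    show "AE x in M. (\<lambda>n. g n x) \<longlonglongrightarrow> 0"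
      using lim
    proof eventually_elim
      case (elim x)
      show ?case
      proof (rule Lim_null_comparison[OF _ elim[THEN tendsto_rabs_zero]])
        show "\<forall>\<^sub>F n in sequentially. norm (g n x) \<le> \<bar>f n x\<bar>"
          by (simp add: g_def)
      qed
    qed
  qed (auto simp: g_def bound c)
  \<comment> \<open>A non-measurable \<open>f n\<close> is not integrable, so its integral takes the
    default value 0.\<close>
  moreover have "(\<integral>x. g n x \<partial>M) = (\<integral>x. f n x \<partial>M)" for n
    using borel_measurable_integrable[of M "f n"] not_integrable_integral_eq[of M "f n"]
    by (auto simp: g_def)
  ultimately show ?thesis
    by simp
qed

lemma (in finite_measure) measure_tendsto_zero:
  assumes "\<And>n. S n \<subseteq> space M"
    and ev: "AE x in M. \<forall>\<^sub>F n in sequentially. x \<notin> S n"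
  shows "(\<lambda>n. measure M (S n)) \<longlonglongrightarrow> 0"
proof -
  have "(\<lambda>n. \<integral>x. indicat_real (S n) x \<partial>M) \<longlonglongrightarrow> 0"
  proof (rule integral_tendsto_zero_bounded)
    show "AE x in M. (\<lambda>n. indicat_real (S n) x) \<longlonglongrightarrow> 0"
      using ev
    proof eventually_elim
      case (elim x)
      then show ?case
        by (intro tendsto_eventually) (auto elim: eventually_mono)
    qed
  qed (auto simp: indicator_def)
  then show ?thesis
    using assms(1) by (simp add: Int_absorb2)
qed

text \<open>By Tonelli the product measure is the integral over \<open>M1\<close> of the slice
  measures, and these are bounded by the mass of \<open>M2\<close>. A non-measurable
  \<open>S n\<close> has measure 0 and is replaced by the empty set \<open>T n\<close>.\<close>

lemma measure_pair_tendsto_zero: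
  assumes "finite_measure M1" "finite_measure M2"
    and slice: "\<And>x. x \<in> space M1 \<Longrightarrow> (\<lambda>n. measure M2 (Pair x -` S n)) \<longlonglongrightarrow> 0"
  shows "(\<lambda>n. measure (M1 \<Otimes>\<^sub>M M2) (S n)) \<longlonglongrightarrow> 0"
proof -
  interpret M1: finite_measure M1 by fact
  interpret M2: finite_measure M2 by fact
  define T where "T n = (if S n \<in> sets (M1 \<Otimes>\<^sub>M M2) then S n else {})" for n
  have T [measurable]: "T n \<in> sets (M1 \<Otimes>\<^sub>M M2)" for n
    by (simp add: T_def)
  have "(\<lambda>n. \<integral>x. measure M2 (Pair x -` T n) \<partial>M1) \<longlonglongrightarrow> 0"
  proof (rule M1.integral_tendsto_zero_bounded[where c = "measure M2 (space M2)"], rule AE_I2)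
    fix x assume "x \<in> space M1"
    from slice[OF this] show "(\<lambda>n. measure M2 (Pair x -` T n)) \<longlonglongrightarrow> 0"
      by (rule Lim_null_comparison[rotated]) (simp add: T_def)
  qed (simp add: M2.bounded_measure)
  moreover have "measure (M1 \<Otimes>\<^sub>M M2) (S n) = (\<integral>x. measure M2 (Pair x -` T n) \<partial>M1)" for n
  proof -
    have "(\<lambda>x. measure M2 (Pair x -` T n)) \<in> borel_measurable M1"
      unfolding measure_def using M2.measurable_emeasure_Pair[OF T] by measurable
    then have "(\<integral>x. measure M2 (Pair x -` T n) \<partial>M1)
        = enn2real (\<integral>\<^sup>+x. emeasure M2 (Pair x -` T n) \<partial>M1)"
      by (subst integral_eq_nn_integral) (simp_all add: M2.emeasure_eq_measure)
    then have "(\<integral>x. measure M2 (Pair x -` T n) \<partial>M1) = measure (M1 \<Otimes>\<^sub>M M2) (T n)"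
      by (simp only: measure_def[of "M1 \<Otimes>\<^sub>M M2"] M2.emeasure_pair_measure_alt[OF T])
    then show ?thesis
      by (auto simp: T_def measure_notin_sets)
  qed
  ultimately show ?thesis
    by simp
qed

lemma prob_space_unit_interval_measure: "prob_space unit_interval_measure"
  by (rule prob_spaceI) (simp add: unit_interval_measure_def emeasure_restrict_space)

section \<open>Levels and support functions of sums and multiples\<close>

lemma level_fuzzy_scale:
  assumes "\<gamma> > 0"
  shows "level (fuzzy_scale \<gamma> A) \<alpha> = (*\<^sub>R) \<gamma> ` level A \<alpha>"
proof -
  \<comment> \<open>One identity for a generic predicate serves both branches of
    \<open>level\<close>.\<close>
  have *: "{x. P (x /\<^sub>R \<gamma>)} = (*\<^sub>R) \<gamma> ` {x. P x}" for P :: "'a \<Rightarrow> bool"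
  proof (intro set_eqI iffI)
    fix x assume "x \<in> {x. P (x /\<^sub>R \<gamma>)}"
    then show "x \<in> (*\<^sub>R) \<gamma> ` {x. P x}"
      using assms by (intro image_eqI[of _ _ "x /\<^sub>R \<gamma>"]) auto
  qed (use assms in auto)
  show ?thesis
    using assms *[of "\<lambda>x. 0 < A x"] *[of "\<lambda>x. \<alpha> \<le> A x"]
    by (auto simp: level_def fuzzy_scale_def closure_scaleR)
qed

lemma fuzzy_scale_fuzzy_sets:
  assumes "\<gamma> > 0" "A \<in> fuzzy_sets"
  shows "fuzzy_scale \<gamma> A \<in> fuzzy_sets"
  using assms
  by (auto simp: fuzzy_sets_def convex_bodies_def level_fuzzy_scale compact_scaling convex_scaling)
     (auto simp: fuzzy_scale_def)

text \<open>Compactness makes the supremum in \<open>fuzzy_add\<close> attained: splittings of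
  \<open>t\<close> at levels increasing to \<alpha> form nested non-empty compact sets, and a common
  point splits \<open>t\<close> at level \<alpha> itself.\<close>

lemma level_fuzzy_add:
  assumes A: "A \<in> fuzzy_sets" and C: "C \<in> fuzzy_sets" and \<alpha>: "0 < \<alpha>" "\<alpha> \<le> 1"
  shows "level (fuzzy_add A C) \<alpha> = {x + y | x y. x \<in> level A \<alpha> \<and> y \<in> level C \<alpha>}"
proof (intro set_eqI iffI)
  fix t assume "t \<in> level (fuzzy_add A C) \<alpha>"
  then have t: "\<alpha> \<le> Sup {min (A x) (C y) | x y. x + y = t}"
    using \<alpha> by (simp add: level_def fuzzy_add_def)
  \<comment> \<open>The double \<open>Suc\<close> gives \<beta> 0 = \<alpha>/2, so every \<beta> k
    is positive and avoids the closure branch of \<open>level\<close>.\<close>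
  define \<beta> where "\<beta> k = \<alpha> * (1 - inverse (real (Suc (Suc k))))" for k
  have \<beta>: "0 < \<beta> k" "\<beta> k < \<alpha>" for k
    using \<alpha> by (simp_all add: \<beta>_def field_simps add_pos_nonneg)
  have \<beta>_mono: "\<beta> m \<le> \<beta> n" if "m \<le> n" for m n
    using \<alpha> that by (auto simp: \<beta>_def intro!: mult_left_mono le_imp_inverse_le)
  have "\<beta> \<longlonglongrightarrow> \<alpha> * (1 - 0)"
    unfolding \<beta>_def using LIMSEQ_inverse_real_of_nat[THEN LIMSEQ_Suc]
    by (intro tendsto_intros) auto
  then have \<beta>_lim: "\<beta> \<longlonglongrightarrow> \<alpha>"
    by simp
  \<comment> \<open>The first summands \<open>x\<close> for which both \<open>x\<close> and
    \<open>t - x\<close> reach level \<beta> k.\<close>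
  define F where "F k = level A (\<beta> k) \<inter> (\<lambda>y. t - y) ` level C (\<beta> k)" for k
  have F_iff: "x \<in> F k \<longleftrightarrow> \<beta> k \<le> A x \<and> \<beta> k \<le> C (t - x)" for x k
    using \<beta>(1)[of k] by (auto simp: F_def level_def image_iff intro!: exI[of _ "t - x"])
  have "\<Inter> (range F) \<noteq> {}"
  proof (rule compact_nest)
    show "compact (F k)" for k
    proof -
      have "\<beta> k \<in> {0..1}"
        using \<beta>[of k] \<alpha> by auto
      then have "compact (level A (\<beta> k))" "compact (level C (\<beta> k))"
        using A C by (auto simp: fuzzy_sets_def convex_bodies_def)
      then show ?thesis
        unfolding F_def
        by (intro compact_Int compact_continuous_image continuous_intros)
    qed
    show "F k \<noteq> {}" for k
    proof -
      \<comment> \<open>Strictness yields an actual splitting above \<beta> k, although the supremum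
        is not yet known to be attained.\<close>
      have "\<beta> k < Sup {min (A x) (C y) | x y. x + y = t}"
        using t \<beta>(2)[of k] by linarith
      moreover have "{min (A x) (C y) | x y. x + y = t} \<noteq> {}"
        using add_0_right[of t] by blast
      ultimately obtain z where "z \<in> {min (A x) (C y) | x y. x + y = t}" "\<beta> k < z"
        by (rule less_cSupE)
      then obtain x y where "x + y = t" "\<beta> k < A x" "\<beta> k < C y"
        by auto
      then have "x \<in> F k"
        by (auto simp: F_iff)
      then show ?thesis
        by blast
    qed
    show "F n \<subseteq> F m" if "m \<le> n" for m n
      using \<beta>_mono[OF that] by (auto simp: F_iff)
  qed
  then obtain x where "\<And>k. x \<in> F k"
    by blast
  then have "\<And>k. \<beta> k \<le> A x" "\<And>k. \<beta> k \<le> C (t - x)"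
    by (simp_all add: F_iff)
  then have "\<alpha> \<le> A x" "\<alpha> \<le> C (t - x)"
    using \<beta>_lim by (auto intro: LIMSEQ_le_const2)
  then show "t \<in> {x + y | x y. x \<in> level A \<alpha> \<and> y \<in> level C \<alpha>}"
    using \<alpha> by (intro CollectI exI[of _ x] exI[of _ "t - x"]) (auto simp: level_def)
next
  fix t assume "t \<in> {x + y | x y. x \<in> level A \<alpha> \<and> y \<in> level C \<alpha>}"
  then obtain x y where xy: "t = x + y" "\<alpha> \<le> A x" "\<alpha> \<le> C y"
    using \<alpha> by (auto simp: level_def)
  have "bdd_above {min (A x) (C y) | x y. x + y = t}"
    using A by (intro bdd_aboveI[of _ 1]) (auto simp: fuzzy_sets_def min_le_iff_disj)
  then have "min (A x) (C y) \<le> Sup {min (A x) (C y) | x y. x + y = t}"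
    using xy(1) by (intro cSup_upper) auto
  then show "t \<in> level (fuzzy_add A C) \<alpha>"
    using \<alpha> xy by (simp add: level_def fuzzy_add_def)
qed

lemma support_fun_attained:
  assumes "A \<in> fuzzy_sets" "\<alpha> \<in> {0..1}"
  obtains a where "a \<in> level A \<alpha>" "support_fun A u \<alpha> = u \<bullet> a"
    "\<And>v. v \<in> level A \<alpha> \<Longrightarrow> u \<bullet> v \<le> u \<bullet> a"
proof -
  have "compact (level A \<alpha>)" "level A \<alpha> \<noteq> {}"
    using assms by (auto simp: fuzzy_sets_def convex_bodies_def)
  then have "\<exists>a\<in>level A \<alpha>. \<forall>v\<in>level A \<alpha>. u \<bullet> v \<le> u \<bullet> a"
    by (intro continuous_attains_sup continuous_intros)
  then obtain a where a: "a \<in> level A \<alpha>" "\<And>v. v \<in> level A \<alpha> \<Longrightarrow> u \<bullet> v \<le> u \<bullet> a"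
    by blast
  then have "support_fun A u \<alpha> = u \<bullet> a"
    unfolding support_fun_def by (intro cSup_eq_maximum) auto
  then show thesis
    using that a by blast
qed

text \<open>On a Minkowski sum a linear functional is maximized by adding maximizers; a positive
  factor preserves maximizers.\<close>

lemma support_fun_add_scale:
  assumes A: "A \<in> fuzzy_sets" and B: "B \<in> fuzzy_sets" and "\<gamma> > 0" "0 < \<alpha>" "\<alpha> \<le> 1"
  shows "support_fun (fuzzy_add A (fuzzy_scale \<gamma> B)) u \<alpha>
    = support_fun A u \<alpha> + \<gamma> * support_fun B u \<alpha>"
proof -
  have \<alpha>: "\<alpha> \<in> {0..1}"
    using assms by simp
  obtain a where a: "a \<in> level A \<alpha>" "support_fun A u \<alpha> = u \<bullet> a"
    "\<And>v. v \<in> level A \<alpha> \<Longrightarrow> u \<bullet> v \<le> u \<bullet> a"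
    by (rule support_fun_attained[OF A \<alpha>, of u]) blast
  obtain b where b: "b \<in> level B \<alpha>" "support_fun B u \<alpha> = u \<bullet> b"
    "\<And>v. v \<in> level B \<alpha> \<Longrightarrow> u \<bullet> v \<le> u \<bullet> b"
    by (rule support_fun_attained[OF B \<alpha>, of u]) blast
  have lev: "level (fuzzy_add A (fuzzy_scale \<gamma> B)) \<alpha>
      = {x + \<gamma> *\<^sub>R y | x y. x \<in> level A \<alpha> \<and> y \<in> level B \<alpha>}"
    using assms by (subst level_fuzzy_add) (auto simp: fuzzy_scale_fuzzy_sets level_fuzzy_scale)
  have "support_fun (fuzzy_add A (fuzzy_scale \<gamma> B)) u \<alpha> = u \<bullet> (a + \<gamma> *\<^sub>R b)"
    unfolding support_fun_def lev
  proof (rule cSup_eq_maximum)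
    show "u \<bullet> (a + \<gamma> *\<^sub>R b) \<in> (\<bullet>) u ` {x + \<gamma> *\<^sub>R y | x y. x \<in> level A \<alpha> \<and> y \<in> level B \<alpha>}"
      using a(1) b(1) by blast
  qed (use a(3) b(3) \<open>\<gamma> > 0\<close> in \<open>auto simp: inner_add_right intro!: add_mono\<close>)
  then show ?thesis
    by (simp add: a(2) b(2) inner_add_right)
qed

section \<open>Escape from the band and the two limits\<close>

lemma eventually_affine_notin_interval:
  fixes a b :: real
  assumes "b \<noteq> 0"
  shows "\<forall>\<^sub>F n in sequentially. a + real n * b \<notin> {l..r}"
proof -
  \<comment> \<open>The filter \<open>at_infinity\<close> concerns the norm only, so both signs of
    \<open>b\<close> are covered at once.\<close>
  have "filterlim (\<lambda>n. real n * b) at_infinity sequentially"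
    using assms tendsto_mult_filterlim_at_infinity[of "\<lambda>_. b" b sequentially real]
    by (simp add: mult.commute filterlim_at_top_imp_at_infinity filterlim_real_sequentially)
  then have "filterlim (\<lambda>n. a + real n * b) at_infinity sequentially"
    by (rule tendsto_add_filterlim_at_infinity[OF tendsto_const])
  then have "\<forall>\<^sub>F n in sequentially. max \<bar>l\<bar> \<bar>r\<bar> + 1 \<le> norm (a + real n * b)"
    by (subst (asm) filterlim_at_infinity[of 0]) auto
  then show ?thesis
    by eventually_elim auto
qed

text \<open>The arbitrary \<open>l\<close> and \<open>r\<close> stand for the band at a fixed
  outcome and direction. For almost every \<alpha> the support function is affine in
  \<open>n\<close> with nonzero slope, so it leaves the band for good.\<close>

lemma measure_slab_tendsto_zero:
  assumes A: "A \<in> fuzzy_sets" and B: "B \<in> fuzzy_nonvanishing" and u: "u \<in> sphere 0 1"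
  shows "(\<lambda>n. measure unit_interval_measure
     {\<alpha> \<in> {0..1}. support_fun (fuzzy_add A (fuzzy_scale (real n) B)) u \<alpha> \<in> {l \<alpha>..r \<alpha>}})
     \<longlonglongrightarrow> 0"
proof -
  interpret prob_space unit_interval_measure
    by (rule prob_space_unit_interval_measure)
  have B': "B \<in> fuzzy_sets"
    using B by (simp add: fuzzy_nonvanishing_def)
  obtain C where C: "C \<in> sets unit_interval_measure" "prob C = 1"
    "\<And>\<alpha>. \<alpha> \<in> C \<Longrightarrow> support_fun B u \<alpha> \<noteq> 0"
    using B u unfolding fuzzy_nonvanishing_def by blast
  have "AE \<alpha> in unit_interval_measure. \<alpha> \<in> C"
    using C(1,2) by (simp add: prob_eq_1)
  \<comment> \<open>Additivity was proved for positive levels; level 0 is a single point of measure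
    zero.\<close>
  moreover have "AE \<alpha> in unit_interval_measure. \<alpha> \<noteq> 0"
    by (rule AE_I[where N = "{0}"])
      (auto simp: unit_interval_measure_def emeasure_restrict_space sets_restrict_space_iff)
  ultimately have "AE \<alpha> in unit_interval_measure. \<forall>\<^sub>F n in sequentially.
      \<alpha> \<notin> {\<alpha> \<in> {0..1}. support_fun (fuzzy_add A (fuzzy_scale (real n) B)) u \<alpha> \<in> {l \<alpha>..r \<alpha>}}"
  proof eventually_elim
    case (elim \<alpha>)
    have "\<forall>\<^sub>F n in sequentially.
        support_fun A u \<alpha> + real n * support_fun B u \<alpha> \<notin> {l \<alpha>..r \<alpha>}"
      using C(3) elim(1) by (intro eventually_affine_notin_interval)
    \<comment> \<open>At \<open>n = 0\<close> the multiple is the indicator of the origin by a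
      separate clause, while \<open>support_fun_add_scale\<close> wants a positive factor.\<close>
    with eventually_gt_at_top[of 0] show ?case
    proof eventually_elim
      case (elim n)
      then show ?case
        using support_fun_add_scale[OF A B', of "real n" \<alpha> u] \<open>\<alpha> \<noteq> 0\<close> by auto
    qed
  qed
  then show ?thesis
    by (intro measure_tendsto_zero) (auto simp: unit_interval_measure_def space_restrict_space)
qed

text \<open>The infimum is squeezed between 0 and its value at one fixed direction \<open>e\<close>,
  so no uniformity in \<open>u\<close> is required.\<close>

lemma depth_FS_tendsto_zero:
  fixes A B :: "real ^ 'n \<Rightarrow> real"
  assumes N: "prob_space N" and A: "A \<in> fuzzy_sets" and B: "B \<in> fuzzy_nonvanishing"
  shows "(\<lambda>n. depth_FS N Xs (fuzzy_add A (fuzzy_scale (real n) B))) \<longlonglongrightarrow> 0"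
proof -
  interpret N: prob_space N by (rule N)
  interpret I: prob_space unit_interval_measure by (rule prob_space_unit_interval_measure)
  define d where "d n u \<omega> = measure unit_interval_measure
     {\<alpha> \<in> {0..1}. support_fun (fuzzy_add A (fuzzy_scale (real n) B)) u \<alpha>
        \<in> {support_min Xs \<omega> u \<alpha> .. support_max Xs \<omega> u \<alpha>}}" for n u \<omega>
  obtain e :: "real ^ 'n" where e: "e \<in> sphere 0 1"
    using vector_choose_size[of 1] by auto
  have "(\<lambda>n. \<integral>\<omega>. d n e \<omega> \<partial>N) \<longlonglongrightarrow> 0"
    by (rule N.integral_tendsto_zero_bounded[where c = 1])
      (use measure_slab_tendsto_zero[OF A B e] in \<open>simp_all add: d_def\<close>)
  then show ?thesis
  proof (rule Lim_null_comparison[rotated], intro always_eventually allI)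
    fix n
    have d_nonneg: "0 \<le> (\<integral>\<omega>. d n u \<omega> \<partial>N)" for u
      by (simp add: d_def)
    have "(INF u\<in>sphere 0 1. \<integral>\<omega>. d n u \<omega> \<partial>N) \<le> (\<integral>\<omega>. d n e \<omega> \<partial>N)"
      using e d_nonneg by (intro cINF_lower bdd_belowI2[where m = 0])
    moreover have "0 \<le> (INF u\<in>sphere 0 1. \<integral>\<omega>. d n u \<omega> \<partial>N)"
      using e d_nonneg by (intro cINF_greatest) auto
    ultimately show "norm (depth_FS N Xs (fuzzy_add A (fuzzy_scale (real n) B)))
        \<le> (\<integral>\<omega>. d n e \<omega> \<partial>N)"
      by (simp add: depth_FS_def d_def)
  qed
qed

text \<open>For each outcome the slab lemma controls every slice over a direction \<open>u\<close>;
  the product lemma integrates over \<open>u\<close>, and bounded convergence over the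
  outcomes.\<close>

lemma depth_mS_tendsto_zero:
  fixes A B :: "real ^ 'n \<Rightarrow> real"
  assumes N: "prob_space N" and A: "A \<in> fuzzy_sets" and B: "B \<in> fuzzy_nonvanishing"
  shows "(\<lambda>n. depth_mS N Xs (fuzzy_add A (fuzzy_scale (real n) B))) \<longlonglongrightarrow> 0"
  unfolding depth_mS_def
proof (rule finite_measure.integral_tendsto_zero_bounded[where c = 1], goal_cases)
  case 1
  show ?case
    using N by (rule prob_space.finite_measure)
next
  case 2
  interpret S: prob_space "sphere_measure :: (real ^ 'n) measure"
    by (rule prob_space_sphere_measure)
  interpret I: prob_space unit_interval_measure
    by (rule prob_space_unit_interval_measure)
  show ?case
  proof (intro AE_I2 measure_pair_tendsto_zero, goal_cases)
    case (3 \<omega> u)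
    then have u: "u \<in> sphere 0 1"
      by simp
    show ?case
      using measure_slab_tendsto_zero[OF A B u, of "support_min Xs \<omega> u" "support_max Xs \<omega> u"] u
      by (simp add: vimage_def)
  qed unfold_locales
next
  case (3 n \<omega>)
  \<comment> \<open>The product is again a probability measure, whence the bound
    \<open>c = 1\<close>.\<close>
  interpret P: pair_prob_space "sphere_measure :: (real ^ 'n) measure" unit_interval_measure
    by (simp add: pair_prob_space_def pair_sigma_finite_def prob_space_sphere_measure
        prob_space_unit_interval_measure prob_space_imp_sigma_finite)
  show ?case
    by simp
qed

theorem proposition5p4:
  fixes M :: "'w measure" and X :: "'w \<Rightarrow> real ^ 'n \<Rightarrow> real"
    and N :: "'v measure" and Xs :: "nat \<Rightarrow> 'v \<Rightarrow> real ^ 'n \<Rightarrow> real"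
    and B :: "real ^ 'n \<Rightarrow> real"
  assumes "prob_space M"
    and "fuzzy_random_variable M X"
    and "independent_copies M X N Xs {1..CARD('n) + 1}"
    and "B \<in> fuzzy_nonvanishing"
  shows "(\<forall>A\<in>fuzzy_sets. (\<forall>A'\<in>fuzzy_sets. depth_FS N Xs A' \<le> depth_FS N Xs A) \<longrightarrow>
           (\<lambda>n. depth_FS N Xs (fuzzy_add A (fuzzy_scale (real n) B))) \<longlonglongrightarrow> 0) \<and>
         (\<forall>A\<in>fuzzy_sets. (\<forall>A'\<in>fuzzy_sets. depth_mS N Xs A' \<le> depth_mS N Xs A) \<longrightarrow>
           (\<lambda>n. depth_mS N Xs (fuzzy_add A (fuzzy_scale (real n) B))) \<longlonglongrightarrow> 0)"
proof -
  have "prob_space N"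
    using assms(3) by (simp add: independent_copies_def)
  then show ?thesis
    using depth_FS_tendsto_zero[OF _ _ assms(4)] depth_mS_tendsto_zero[OF _ _ assms(4)] by blast
qed

end
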